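(* Let $\mathbf{p}=\{p_1,\dots,p_n\}$ and $\mathbf{r}=\{r_1,\dots,r_n\}$ be two probability distributions with $p_j>0$ and $r_j>0$ for all $j=1,\dots,n$, and let $q\ge 0$ with $q\ne 1$. Then $$JS_q(\mathbf{p}|\mathbf{r})\le \frac14 J_q(\mathbf{p}|\mathbf{r}).$$
   Context: A probability distribution satisfies $\sum_j p_j=1$. For probability distributions $\mathbf{p},\mathbf{r}$ with positive entries and $q\ge0$, $q\ne1$, the Tsallis divergence is $D_q^T(\mathbf{p}|\mathbf{r}):=\sum_{j=1}^n\frac{p_j-p_j^qr_j^{1-q}}{1-q}$. The Jeffreys-Tsallis divergence is $J_q(\mathbf{p}|\mathbf{r}):=D_q^T(\mathbf{p}|\mathbf{r})+D_q^T(\mathbf{r}|\mathbf{p})$. The Jensen-Shannon-Tsallis divergence is $JS_q(\mathbf{p}|\mathbf{r}):=\frac12D_q^T\left(\mathbf{p}\,\Big|\,\frac{\mathbf{p}+\mathbf{r}}{2}\right)+\frac12D_q^T\left(\mathbf{r}\,\Big|\,\frac{\mathbf{p}+\mathbf{r}}{2}\right)$, where $\frac{\mathbf{p}+\mathbf{r}}{2}$ is the distribution with entries $\frac{p_j+r_j}{2}$. *)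

theory Defs
  imports Complex_Main
begin

text \<open>
  A distribution with n entries is a function on the naturals of which only the values at
  1, ..., n are used. The real power \<open>powr\<close> is the usual one on positive bases, which is the
  only case relevant for the divergences below: they are meant for positive entries and q \<noteq> 1.
\<close>

definition prob_distribution :: "nat \<Rightarrow> (nat \<Rightarrow> real) \<Rightarrow> bool" where
  "prob_distribution n p \<longleftrightarrow> (\<forall>j\<in>{1..n}. 0 \<le> p j) \<and> (\<Sum>j=1..n. p j) = 1"

definition tsallis_divergence :: "real \<Rightarrow> nat \<Rightarrow> (nat \<Rightarrow> real) \<Rightarrow> (nat \<Rightarrow> real) \<Rightarrow> real" where
  "tsallis_divergence q n p r =
     (\<Sum>j=1..n. (p j - p j powr q * r j powr (1 - q)) / (1 - q))"

definition jeffreys_tsallis :: "real \<Rightarrow> nat \<Rightarrow> (nat \<Rightarrow> real) \<Rightarrow> (nat \<Rightarrow> real) \<Rightarrow> real" where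
  "jeffreys_tsallis q n p r = tsallis_divergence q n p r + tsallis_divergence q n r p"

definition jensen_shannon_tsallis :: "real \<Rightarrow> nat \<Rightarrow> (nat \<Rightarrow> real) \<Rightarrow> (nat \<Rightarrow> real) \<Rightarrow> real" where
  "jensen_shannon_tsallis q n p r =
     1/2 * tsallis_divergence q n p (\<lambda>j. (p j + r j) / 2) +
     1/2 * tsallis_divergence q n r (\<lambda>j. (p j + r j) / 2)"

end

theory Submission
  imports Defs "HOL-Analysis.Convex"
begin

text \<open>
  Jensen's inequality in the second argument: for fixed \<open>a > 0\<close> the summand
  \<open>d(a, y) = (a - a powr q * y powr (1 - q)) / (1 - q)\<close> of the Tsallis divergence has second
  derivative \<open>q * a powr q * y powr (-q - 1)\<close>, which is nonnegative precisely because \<open>0 \<le> q\<close>, on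
  either side of \<open>q = 1\<close>. So \<open>d(a, \<cdot>)\<close> is convex. Since moreover \<open>d(a, a) = 0\<close>, moving only halfway
  from \<open>a\<close> to \<open>b\<close> costs at most half: \<open>d(a, (a + b) / 2) \<le> d(a, b) / 2\<close>. Summed over the entries,
  the divergence to the mixture is at most half the divergence to the other distribution; averaging
  this bound with its mirror image turns the factor \<open>1/2\<close> into \<open>1/4\<close>.
\<close>

lemma convex_on_tsallis_term:
  fixes a q :: real
  assumes "0 \<le> q" and "q \<noteq> 1"
  shows "convex_on {0<..} (\<lambda>y. (a - a powr q * y powr (1 - q)) / (1 - q))"
proof (rule f''_ge0_imp_convex)
  fix y :: real
  assume "y \<in> {0<..}"
  then have y: "0 < y" by simp
  have "((\<lambda>y. y powr (1 - q)) has_real_derivative (1 - q) * y powr (- q)) (at y)"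
    using has_real_derivative_powr[OF y, of "1 - q"] by simp
  from DERIV_cdivide[OF DERIV_diff[OF DERIV_const[of a] DERIV_cmult[OF this, of "a powr q"]], of "1 - q"]
  show "((\<lambda>y. (a - a powr q * y powr (1 - q)) / (1 - q)) has_real_derivative
      - (a powr q * y powr (- q))) (at y)"
    using assms(2) by simp
  show "((\<lambda>y. - (a powr q * y powr (- q))) has_real_derivative
      a powr q * (q * y powr (- q - 1))) (at y)"
    using y by (auto intro!: derivative_eq_intros)
  show "0 \<le> a powr q * (q * y powr (- q - 1))"
    using assms by simp
qed simp

lemma tsallis_term_midpoint_le:
  fixes a b q :: real
  assumes "0 < a" and "0 < b" and "0 \<le> q" and "q \<noteq> 1"
  shows "(a - a powr q * ((a + b) / 2) powr (1 - q)) / (1 - q)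
    \<le> 1/2 * ((a - a powr q * b powr (1 - q)) / (1 - q))"
proof -
  \<comment> \<open>The diagonal value of the summand vanishes, so only the term at \<open>b\<close> survives in the
    midpoint inequality.\<close>
  have diag: "a powr q * a powr (1 - q) = a"
    using assms by (simp flip: powr_add)
  show ?thesis
    using convex_onD[OF convex_on_tsallis_term[OF assms(3,4), of a], of "1/2" a b] assms(1,2)
    by (simp add: diag add_divide_distrib)
qed

lemma tsallis_divergence_midpoint_le:
  fixes p r :: "nat \<Rightarrow> real" and q :: real
  assumes "\<And>j. j \<in> {1..n} \<Longrightarrow> 0 < p j" and "\<And>j. j \<in> {1..n} \<Longrightarrow> 0 < r j"
    and "0 \<le> q" and "q \<noteq> 1"
  shows "tsallis_divergence q n p (\<lambda>j. (p j + r j) / 2) \<le> 1/2 * tsallis_divergence q n p r"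
  unfolding tsallis_divergence_def sum_distrib_left
  using assms by (intro sum_mono tsallis_term_midpoint_le) auto

theorem theorem3p3:
  fixes p r :: "nat \<Rightarrow> real" and n :: nat and q :: real
  assumes "prob_distribution n p" and "prob_distribution n r"
    and "\<And>j. j \<in> {1..n} \<Longrightarrow> 0 < p j" and "\<And>j. j \<in> {1..n} \<Longrightarrow> 0 < r j"
    and "0 \<le> q" and "q \<noteq> 1"
  shows "jensen_shannon_tsallis q n p r \<le> 1/4 * jeffreys_tsallis q n p r"
proof -
  have "tsallis_divergence q n p (\<lambda>j. (p j + r j) / 2) \<le> 1/2 * tsallis_divergence q n p r"
    using assms by (intro tsallis_divergence_midpoint_le)
  moreover have "tsallis_divergence q n r (\<lambda>j. (p j + r j) / 2) \<le> 1/2 * tsallis_divergence q n r p"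
    using tsallis_divergence_midpoint_le[of n r p q] assms by (simp add: add.commute)
  ultimately show ?thesis
    unfolding jensen_shannon_tsallis_def jeffreys_tsallis_def by simp
qed

end
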